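(* Let $\alpha>0$, $\varepsilon>0$, and let $X=\{(\lambda,m_\lambda)\}_{\lambda\in\Lambda}$ be a divisor in $\mathbb{D}$ such that $$\bigcup_{\lambda\in\Lambda}D\left(\lambda,\sqrt{\frac{m_\lambda}{\alpha+\varepsilon+m_\lambda}}\right)=\mathbb{D}\setminus K$$ for some compact set $K\subset\mathbb{D}$. Then $X$ is a uniqueness divisor for $\mathcal{A}^\infty_\alpha$.
   Context: $\mathbb{D}$ is the open unit disk in $\mathbb{C}$. For $\alpha>0$, $\mathcal{A}^\infty_\alpha$ is the space of holomorphic functions $f$ on $\mathbb{D}$ with $\|f\|_{\alpha,\infty}:=\sup_{z\in\mathbb{D}}(1-|z|^2)^{\alpha/2}|f(z)|<\infty$. For $\lambda\in\mathbb{D}$ and $0<r<1$, $D(\lambda,r)=\{z\in\mathbb{D}:\left|\frac{\lambda-z}{1-\overline{\lambda}z}\right|<r\}$ is the pseudohyperbolic disk. A divisor is a set $X=\{(\lambda,m_\lambda)\}_{\lambda\in\Lambda}$, where $\Lambda\subset\mathbb{D}$ is a set of (distinct) points and each $m_\lambda\ge1$ is an integer (multiplicity). $X$ is a uniqueness divisor for a space $\mathcal{A}$ of holomorphic functions on $\mathbb{D}$ if every $f\in\mathcal{A}$ with $f^{(j)}(\lambda)=0$ for all $\lambda\in\Lambda$ and $0\le j<m_\lambda$ is identically zero. *)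

theory Defs
  imports "HOL-Analysis.Analysis"
begin

abbreviation unit_disk :: "complex set" where
  "unit_disk \<equiv> ball 0 1"

text \<open>The supremum is taken in the extended nonnegative reals, so that it is \<open>\<infinity>\<close>
  exactly when the weighted function is unbounded.\<close>

definition growth_norm :: "real \<Rightarrow> (complex \<Rightarrow> complex) \<Rightarrow> ennreal" where
  "growth_norm \<alpha> f =
     (SUP z\<in>unit_disk. ennreal ((1 - (cmod z)\<^sup>2) powr (\<alpha> / 2) * cmod (f z)))"

text \<open>Elements are total functions; only their values on the disk matter.\<close>

definition growth_space :: "real \<Rightarrow> (complex \<Rightarrow> complex) set" where
  "growth_space \<alpha> = {f. f holomorphic_on unit_disk \<and> growth_norm \<alpha> f < \<infinity>}"

definition pseudohyperbolic_disk :: "complex \<Rightarrow> real \<Rightarrow> complex set" where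
  "pseudohyperbolic_disk w r = {z \<in> unit_disk. cmod ((w - z) / (1 - cnj w * z)) < r}"

text \<open>A divisor is a set of pairs (point, multiplicity); single-valuedness says that each
  point occurs with only one multiplicity.\<close>

definition divisor :: "(complex \<times> nat) set \<Rightarrow> bool" where
  "divisor X \<longleftrightarrow> single_valued X \<and> (\<forall>(w, m)\<in>X. w \<in> unit_disk \<and> 1 \<le> m)"

text \<open>Being identically zero is meant on the disk, the domain of the functions in \<open>A\<close>.\<close>

definition uniqueness_divisor ::
    "(complex \<times> nat) set \<Rightarrow> (complex \<Rightarrow> complex) set \<Rightarrow> bool" where
  "uniqueness_divisor X A \<longleftrightarrow>
     (\<forall>f\<in>A. (\<forall>(w, m)\<in>X. \<forall>j<m. (deriv ^^ j) f w = 0) \<longrightarrow> (\<forall>z\<in>unit_disk. f z = 0))"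

end

theory Submission
  imports Defs "HOL-Complex_Analysis.Complex_Analysis"
begin

text \<open>Put \<open>\<beta> = \<alpha> + \<epsilon>\<close> and suppose that \<open>f \<noteq> 0\<close> vanishes on \<open>X\<close>. The weighted modulus
  \<open>V z = (1 - |z|\<^sup>2) powr (\<beta> / 2) * |z ^ N * f z|\<close> tends to 0 at the unit circle, because of the
  surplus \<open>\<epsilon>\<close>, so it attains its maximum over the disk; for large \<open>N\<close> the factor \<open>z ^ N\<close> keeps the
  maximum point away from the compact set \<open>K\<close>, hence puts it in one of the pseudohyperbolic disks
  about a zero \<open>w\<close> of multiplicity \<open>m\<close>. With \<open>t\<close> the pseudohyperbolic distance from \<open>z\<close> to \<open>w\<close>, \<open>V\<close>
  is, up to a constant, \<open>t ^ m * (1 - t\<^sup>2) powr (\<beta> / 2)\<close> times the modulus of a holomorphic function.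
  The first factor increases up to \<open>t = sqrt (m / (\<beta> + m))\<close>, the radius of the disk, so by the
  maximum principle \<open>V\<close> takes a larger value on the boundary of that disk.\<close>

section \<open>Splitting off the zero at a point of the divisor\<close>

text \<open>Dividing by \<open>z - a\<close> once lowers the order of the zero by one, so induction
  on \<open>m\<close> applies. Nothing is claimed about \<open>h a\<close>, hence \<open>f\<close>
  may vanish identically.\<close>

lemma holomorphic_factor_zero_of_order:
  assumes "f holomorphic_on S" "open S" "a \<in> S"
    and "\<And>j. j < m \<Longrightarrow> (deriv ^^ j) f a = 0"
  obtains h where "h holomorphic_on S" "\<And>z. z \<in> S \<Longrightarrow> f z = (z - a) ^ m * h z"
  using assms
proof (induction m arbitrary: f thesis)
  case 0
  then show ?case by force
next
  case (Suc m)
  define g where "g = (\<lambda>z. if z = a then deriv f a else (f z - f a) / (z - a))"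
  have g: "g holomorphic_on S"
    unfolding g_def using Suc.prems by (intro pole_lemma) (auto simp: interior_open)
  have fa: "f a = 0"
    using Suc.prems(5)[of 0] by simp
  have f_eq: "f z = (z - a) * g z" for z
    by (simp add: g_def fa)
  have "(deriv ^^ j) g a = 0" if "j < m" for j
  proof -
    have "(deriv ^^ Suc j) f a = (\<Sum>i=0..Suc j. of_nat (Suc j choose i) *
        (deriv ^^ i) (\<lambda>z. z - a) a * (deriv ^^ (Suc j - i)) g a)"
      unfolding f_eq using g Suc.prems(3,4)
      by (intro higher_deriv_mult) (auto intro!: holomorphic_intros)
    \<comment> \<open>In the Leibniz sum only \<open>i = 1\<close> survives: \<open>z - a\<close>
      vanishes at \<open>a\<close>, and so do its derivatives of order at least 2.\<close>
    also have "\<dots> = (\<Sum>i\<in>{1}. of_nat (Suc j choose i) *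
        (deriv ^^ i) (\<lambda>z. z - a) a * (deriv ^^ (Suc j - i)) g a)"
    proof (intro sum.mono_neutral_right ballI)
      fix i assume "i \<in> {0..Suc j} - {1}"
      moreover have "(deriv ^^ i) (\<lambda>z. z - a) a = (deriv ^^ i) (\<lambda>z. z) a - (deriv ^^ i) (\<lambda>z. a) a"
        by (rule higher_deriv_diff[of _ UNIV]) (auto intro!: holomorphic_intros)
      ultimately show "of_nat (Suc j choose i) * (deriv ^^ i) (\<lambda>z. z - a) a *
          (deriv ^^ (Suc j - i)) g a = 0"
        by auto
    qed auto
    also have "\<dots> = of_nat (Suc j) * (deriv ^^ j) g a"
      by simp
    finally show ?thesis
      using Suc.prems(5)[of "Suc j"] that of_nat_neq_0[of j, where 'a=complex]
      by (metis Suc_less_eq mult_eq_0_iff)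
  qed
  then obtain h where h: "h holomorphic_on S" "\<And>z. z \<in> S \<Longrightarrow> g z = (z - a) ^ m * h z"
    using Suc.IH[of g] g Suc.prems by blast
  show ?case
    by (rule Suc.prems(1)[OF h(1)]) (simp add: f_eq h(2))
qed

section \<open>Pseudohyperbolic geometry and the comparison on a single disk\<close>

text \<open>Divided by the first square, this is the formula for 1 minus the squared
  pseudohyperbolic distance. The undivided form also serves for \<open>z\<close> on the unit
  circle.\<close>

lemma pseudohyperbolic_identity:
  "(cmod (1 - cnj w * z))\<^sup>2 - (cmod (w - z))\<^sup>2 = (1 - (cmod w)\<^sup>2) * (1 - (cmod z)\<^sup>2)"
  by (simp add: cmod_power2) (simp add: power2_eq_square algebra_simps)

text \<open>Used twice: the denominator of the Moebius quotient has no zero on the closed disk, and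
  on the open disk it avoids the branch cut of \<open>Ln\<close>.\<close>

lemma one_minus_cnj_mult_Re_pos:
  assumes "cmod w < 1" "cmod z \<le> 1"
  shows "0 < Re (1 - cnj w * z)"
proof -
  have "Re (cnj w * z) \<le> cmod w * cmod z"
    by (metis complex_Re_le_cmod complex_mod_cnj norm_mult)
  also have "\<dots> \<le> cmod w"
    using assms by (simp add: mult_left_le)
  finally show ?thesis
    using assms by simp
qed

text \<open>Take logarithms and bound both ratios to the values at \<open>r\<close> by
  \<open>ln x \<le> x - 1\<close>; strictness comes from
  \<open>t\<^sup>2 / r\<^sup>2 \<noteq> 1\<close>.\<close>

lemma power_mult_powr_less_critical:
  fixes \<beta> t :: real
  assumes "0 < \<beta>" "1 \<le> m" "0 < t" "t < r" and r: "r\<^sup>2 = real m / (\<beta> + real m)"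
  shows "t ^ m * (1 - t\<^sup>2) powr (\<beta> / 2) < r ^ m * (1 - r\<^sup>2) powr (\<beta> / 2)"
proof -
  have m: "0 < real m" and "0 < r"
    using assms by auto
  have r1: "1 - r\<^sup>2 = \<beta> / (\<beta> + real m)"
    using assms m by (simp add: r field_simps)
  then have r1_pos: "0 < 1 - r\<^sup>2"
    using assms m by simp
  have t2: "t\<^sup>2 < r\<^sup>2"
    using assms(3,4) by (intro power_strict_mono) auto
  have t_ratio: "t\<^sup>2 / r\<^sup>2 \<noteq> 1"
    using t2 by auto
  have *: "ln (t\<^sup>2 / r\<^sup>2) < t\<^sup>2 / r\<^sup>2 - 1"
    using ln_le_minus_one[of "t\<^sup>2 / r\<^sup>2"] ln_eq_minus_one[of "t\<^sup>2 / r\<^sup>2"] t_ratio \<open>0 < t\<close> \<open>0 < r\<close>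
    by fastforce
  have **: "ln ((1 - t\<^sup>2) / (1 - r\<^sup>2)) \<le> (1 - t\<^sup>2) / (1 - r\<^sup>2) - 1"
    using t2 r1_pos by (intro ln_le_minus_one) auto
  have "real m * ln (t\<^sup>2 / r\<^sup>2) + \<beta> * ln ((1 - t\<^sup>2) / (1 - r\<^sup>2))
      < real m * (t\<^sup>2 / r\<^sup>2 - 1) + \<beta> * ((1 - t\<^sup>2) / (1 - r\<^sup>2) - 1)"
    using * ** m \<open>0 < \<beta>\<close> by (intro add_less_le_mono) simp_all
  \<comment> \<open>\<open>m / r\<^sup>2\<close> and \<open>\<beta> / (1 - r\<^sup>2)\<close> both
    equal \<open>\<beta> + m\<close>, so the linear terms cancel; this is where the critical radius
    enters.\<close>
  also have "\<dots> = 0"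
    unfolding r1 unfolding r using m \<open>0 < \<beta>\<close> by (simp add: field_simps)
  finally have "real m * ln t + \<beta> / 2 * ln (1 - t\<^sup>2) < real m * ln r + \<beta> / 2 * ln (1 - r\<^sup>2)"
    using t2 r1_pos \<open>0 < t\<close> \<open>0 < r\<close> by (simp add: ln_div ln_realpow algebra_simps)
  then have "exp (real m * ln t + \<beta> / 2 * ln (1 - t\<^sup>2)) < exp (real m * ln r + \<beta> / 2 * ln (1 - r\<^sup>2))"
    by simp
  then show ?thesis
    using t2 r1_pos \<open>0 < t\<close> \<open>0 < r\<close> by (simp add: exp_add powr_def exp_of_nat_mult)
qed

text \<open>The hypothesis \<open>nz\<close> makes the gain strict: it keeps \<open>z0\<close> away
  from \<open>w\<close> and \<open>H z0\<close> away from 0, so the increase of \<open>q\<close>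
  survives multiplication by \<open>cmod (H z0)\<close>.\<close>

lemma exists_greater_weighted_value:
  fixes \<beta> :: real
  assumes "0 < \<beta>" "1 \<le> m" "w \<in> unit_disk" and h: "h holomorphic_on unit_disk"
    and z0: "z0 \<in> pseudohyperbolic_disk w (sqrt (real m / (\<beta> + real m)))"
    and nz: "(z0 - w) ^ m * h z0 \<noteq> 0"
  obtains z where "z \<in> unit_disk"
    "(1 - (cmod z0)\<^sup>2) powr (\<beta> / 2) * cmod ((z0 - w) ^ m * h z0)
      < (1 - (cmod z)\<^sup>2) powr (\<beta> / 2) * cmod ((z - w) ^ m * h z)"
proof -
  define r where "r = sqrt (real m / (\<beta> + real m))"
  define S where "S = pseudohyperbolic_disk w r"
  define \<phi> where "\<phi> z = cmod ((w - z) / (1 - cnj w * z))" for z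
  define q where "q t = t ^ m * (1 - t\<^sup>2) powr (\<beta> / 2)" for t :: real
  define V where "V z = (1 - (cmod z)\<^sup>2) powr (\<beta> / 2) * cmod ((z - w) ^ m * h z)" for z
  define H where "H z = h z * (1 - cnj w * z) ^ m * exp (of_real \<beta> * Ln (1 - cnj w * z))" for z
  have w: "cmod w < 1"
    using assms by simp
  have r2: "r\<^sup>2 = real m / (\<beta> + real m)" and r: "0 < r" "r < 1"
    using assms by (auto simp: r_def)
  have den: "1 - cnj w * z \<noteq> 0" if "cmod z \<le> 1" for z
    using one_minus_cnj_mult_Re_pos[OF w that] by (metis less_irrefl zero_complex.sel(1))
  define c where "c = (1 - (cmod w)\<^sup>2) powr (\<beta> / 2)"
  have c: "0 < c"
    using w abs_square_less_1[of "cmod w"] by (simp add: c_def)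
  \<comment> \<open>\<open>H\<close> absorbs all powers of the denominator of \<open>\<phi>\<close>; its base has positive real part, so the
    principal branch is holomorphic.\<close>
  have V_eq: "c * V z = q (\<phi> z) * cmod (H z)" if z: "z \<in> unit_disk" for z
  proof -
    define d where "d = cmod (1 - cnj w * z)"
    have d: "0 < d"
      using den[of z] z by (simp add: d_def)
    have \<phi>: "cmod (z - w) = \<phi> z * d"
      using d by (simp add: \<phi>_def d_def norm_divide norm_minus_commute)
    have id: "(1 - (\<phi> z)\<^sup>2) * d\<^sup>2 = (1 - (cmod w)\<^sup>2) * (1 - (cmod z)\<^sup>2)"
      using pseudohyperbolic_identity[of w z]
      unfolding d_def[symmetric] norm_minus_commute[of w] \<phi>
      by (simp add: left_diff_distrib power_mult_distrib)
    have nn: "0 < 1 - (cmod w)\<^sup>2" "0 < 1 - (cmod z)\<^sup>2"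
      using w z by (simp_all add: abs_square_less_1)
    have "0 < (1 - (\<phi> z)\<^sup>2) * d\<^sup>2"
      unfolding id using nn by simp
    then have nn': "0 < 1 - (\<phi> z)\<^sup>2"
      using d by (simp add: zero_less_mult_iff)
    have H: "cmod (H z) = cmod (h z) * d ^ m * d powr \<beta>"
      using den[of z] z by (simp add: H_def d_def norm_mult norm_power powr_def)
    have "c * (1 - (cmod z)\<^sup>2) powr (\<beta> / 2) = ((1 - (\<phi> z)\<^sup>2) * d\<^sup>2) powr (\<beta> / 2)"
      unfolding id c_def using nn by (simp add: powr_mult)
    also have "\<dots> = (1 - (\<phi> z)\<^sup>2) powr (\<beta> / 2) * d powr \<beta>"
      using nn' d by (simp add: powr_mult powr_powr flip: powr_numeral)
    finally have "c * V z = (1 - (\<phi> z)\<^sup>2) powr (\<beta> / 2) * d powr \<beta> * (\<phi> z * d) ^ m * cmod (h z)"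
      by (simp add: V_def norm_mult norm_power \<phi>)
    then show ?thesis
      by (simp add: H q_def power_mult_distrib)
  qed
  have S_eq: "S = {z \<in> unit_disk. cmod (w - z) < r * cmod (1 - cnj w * z)}"
    unfolding S_def pseudohyperbolic_disk_def
    using den by (auto simp: norm_divide divide_less_eq)
  have "open {z. cmod (w - z) < r * cmod (1 - cnj w * z)}"
    by (intro open_Collect_less continuous_intros)
  then have "open (unit_disk \<inter> {z. cmod (w - z) < r * cmod (1 - cnj w * z)})"
    by (intro open_Int open_ball)
  then have "open S"
    by (simp only: S_eq Collect_conj_eq Collect_mem_eq)
  have clS: "closure S \<subseteq> {z. cmod z \<le> 1 \<and> cmod (w - z) \<le> r * cmod (1 - cnj w * z)}"
    by (rule closure_minimal) (auto simp: S_eq intro!: closed_Collect_conj closed_Collect_le continuous_intros)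
  \<comment> \<open>For \<open>cmod z = 1\<close> the identity makes both moduli equal, which
    \<open>r < 1\<close> excludes.\<close>
  have cl: "closure S \<subseteq> unit_disk"
  proof
    fix z assume "z \<in> closure S"
    then have z: "cmod z \<le> 1" "cmod (w - z) \<le> r * cmod (1 - cnj w * z)"
      using clS by auto
    have "r * cmod (1 - cnj w * z) < cmod (1 - cnj w * z)"
      using r den[OF z(1)] by simp
    then have "(cmod (w - z))\<^sup>2 < (cmod (1 - cnj w * z))\<^sup>2"
      using z by (intro power_strict_mono) auto
    then have "cmod z \<noteq> 1"
      using pseudohyperbolic_identity[of w z] by auto
    then show "z \<in> unit_disk"
      using z by simp
  qed
  have holH: "H holomorphic_on unit_disk"
    unfolding H_def
    by (intro holomorphic_intros h)
       (metis one_minus_cnj_mult_Re_pos[OF w] complex_nonpos_Reals_iff not_less mem_ball_0 less_imp_le)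
  have "z0 \<in> S"
    using z0 by (simp add: S_def r_def)
  then have z0': "z0 \<in> unit_disk" "\<phi> z0 < r"
    by (auto simp: S_def pseudohyperbolic_disk_def \<phi>_def)
  have \<phi>0: "0 < \<phi> z0"
    using nz den[of z0] z0' \<open>1 \<le> m\<close> by (auto simp: \<phi>_def)
  have H0: "0 < cmod (H z0)"
    using nz den[of z0] z0' by (simp add: H_def)
  have "\<exists>z\<in>frontier S. cmod (H z0) \<le> cmod (H z)"
  proof (rule ccontr)
    assume "\<not> ?thesis"
    then have less: "\<And>z. z \<in> frontier S \<Longrightarrow> cmod (H z) < cmod (H z0)"
      by force
    have bdd: "bounded S"
      by (rule bounded_subset[of unit_disk]) (auto simp: S_eq)
    have "frontier S \<noteq> {}"
      using \<open>z0 \<in> S\<close> bdd by (metis frontier_eq_empty emptyE not_bounded_UNIV)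
    moreover have cf: "compact (frontier S)"
      using bdd by (rule compact_frontier_bounded)
    moreover have "continuous_on (frontier S) (\<lambda>z. cmod (H z))"
      using holomorphic_on_imp_continuous_on[OF holH] cl
      by (intro continuous_intros) (auto simp: frontier_def intro: continuous_on_subset)
    \<comment> \<open>The maximum principle takes a constant bound on the frontier; the maximum of
      \<open>cmod (H z)\<close> there is such a bound, and it is attained.\<close>
    ultimately obtain z where z: "z \<in> frontier S"
      "\<And>y. y \<in> frontier S \<Longrightarrow> cmod (H y) \<le> cmod (H z)"
      using continuous_attains_sup by metis
    have "cmod (H z0) \<le> cmod (H z)"
    proof (rule maximum_modulus_frontier[of H S])
      show "H holomorphic_on interior S"
        using holH cl interior_subset closure_subset by (meson holomorphic_on_subset order_trans)
      show "continuous_on (closure S) H"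
        using holomorphic_on_imp_continuous_on[OF holH] cl by (rule continuous_on_subset)
    qed (use bdd z \<open>z0 \<in> S\<close> in auto)
    then show False
      using less[OF z(1)] by simp
  qed
  then obtain z where z: "z \<in> frontier S" "cmod (H z0) \<le> cmod (H z)"
    by blast
  \<comment> \<open>The closure gives \<open>\<phi> z \<le> r\<close>, and openness of
    \<open>S\<close> rules out \<open>\<phi> z < r\<close>.\<close>
  have zD: "z \<in> unit_disk" and zS: "z \<notin> S"
    using z(1) cl \<open>open S\<close> by (auto simp: frontier_def interior_open)
  have "cmod (w - z) \<le> r * cmod (1 - cnj w * z)"
    using z(1) clS by (auto simp: frontier_def)
  then have "\<phi> z \<le> r"
    using den[of z] zD by (simp add: \<phi>_def norm_divide divide_le_eq)
  moreover have "\<not> \<phi> z < r"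
    using zS zD by (simp add: S_def pseudohyperbolic_disk_def \<phi>_def)
  ultimately have \<phi>z: "\<phi> z = r"
    by simp
  have q: "q (\<phi> z0) < q r"
    unfolding q_def using power_mult_powr_less_critical[OF assms(1,2) \<phi>0 z0'(2) r2] .
  have "0 \<le> q r"
    using r by (simp add: q_def)
  have "c * V z0 = q (\<phi> z0) * cmod (H z0)"
    using V_eq z0' by simp
  also have "\<dots> < q r * cmod (H z0)"
    using q H0 by simp
  also have "\<dots> \<le> q r * cmod (H z)"
    using z(2) \<open>0 \<le> q r\<close> by (rule mult_left_mono)
  also have "\<dots> = c * V z"
    using V_eq[OF zD] \<phi>z by simp
  finally have "V z0 < V z"
    using c by simp
  then show ?thesis
    using that[OF zD] by (simp add: V_def)
qed

section \<open>Growth bounds and maxima on the disk\<close>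

lemma growth_space_bound:
  assumes "f \<in> growth_space \<alpha>"
  obtains C where "0 < C" "\<And>z. z \<in> unit_disk \<Longrightarrow> (1 - (cmod z)\<^sup>2) powr (\<alpha> / 2) * cmod (f z) \<le> C"
proof -
  have fin: "growth_norm \<alpha> f < \<infinity>"
    using assms by (simp add: growth_space_def)
  show ?thesis
  \<comment> \<open>Adding 1 keeps the bound positive when the norm is 0.\<close>
  proof (rule that[of "enn2real (growth_norm \<alpha> f) + 1"])
    fix z assume "z \<in> unit_disk"
    then have "ennreal ((1 - (cmod z)\<^sup>2) powr (\<alpha> / 2) * cmod (f z)) \<le> growth_norm \<alpha> f"
      unfolding growth_norm_def by (rule SUP_upper)
    also have "\<dots> = ennreal (enn2real (growth_norm \<alpha> f))"
      using fin by simp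
    finally show "(1 - (cmod z)\<^sup>2) powr (\<alpha> / 2) * cmod (f z) \<le> enn2real (growth_norm \<alpha> f) + 1"
      by (simp add: ennreal_le_iff)
  qed (simp add: add_nonneg_pos)
qed

text \<open>By the identity theorem \<open>f\<close> cannot vanish on a whole outer annulus. This
  supplies a comparison point farther out than all of \<open>K\<close>.\<close>

lemma holomorphic_on_disk_nonzero_near_boundary:
  assumes "f holomorphic_on unit_disk" "z \<in> unit_disk" "f z \<noteq> 0" "0 \<le> \<rho>" "\<rho> < 1"
  obtains z1 where "z1 \<in> unit_disk" "\<rho> < cmod z1" "f z1 \<noteq> 0"
proof (rule ccontr)
  note * = that
  assume neg: "\<not> thesis"
  define A where "A = unit_disk - cball 0 \<rho>"
  have fA: "f z = 0" if "z \<in> A" for z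
    using that neg *[of z] by (auto simp: A_def not_le)
  have "complex_of_real ((\<rho> + 1) / 2) \<in> A"
    using assms by (simp add: A_def field_simps flip: of_real_add)
  then have "A \<noteq> {}"
    by blast
  then have "f z = 0"
    using assms fA
    by (intro analytic_continuation_open[of A unit_disk f "\<lambda>_. 0" z]) (auto simp: A_def)
  then show False
    using assms by simp
qed

lemma continuous_decay_attains_max_on_disk:
  fixes V :: "complex \<Rightarrow> real"
  assumes "continuous_on unit_disk V" "0 < \<gamma>" "0 < C"
    and le: "\<And>z. z \<in> unit_disk \<Longrightarrow> V z \<le> C * (1 - (cmod z)\<^sup>2) powr \<gamma>"
    and z1: "z1 \<in> unit_disk" "0 < V z1"
  obtains z0 where "z0 \<in> unit_disk" "\<And>z. z \<in> unit_disk \<Longrightarrow> V z \<le> V z0"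
proof -
  \<comment> \<open>Solves \<open>C * \<delta> powr \<gamma> = V z1\<close>, so the decay bound lies
    below \<open>V z1\<close> outside the compact set \<open>T\<close>.\<close>
  define \<delta> where "\<delta> = (V z1 / C) powr (1 / \<gamma>)"
  have \<delta>: "0 < \<delta>" "\<delta> powr \<gamma> = V z1 / C"
    using assms by (auto simp: \<delta>_def powr_powr)
  define T where "T = {z. (cmod z)\<^sup>2 \<le> 1 - \<delta>}"
  have T: "T \<subseteq> unit_disk"
  proof
    fix z assume "z \<in> T"
    then have "(cmod z)\<^sup>2 < 1"
      using \<delta> by (simp add: T_def)
    then show "z \<in> unit_disk"
      by (simp add: abs_square_less_1)
  qed
  have "closed T"
    unfolding T_def by (intro closed_Collect_le continuous_intros)
  then have "compact T"
    using T bounded_subset bounded_ball by (auto simp: compact_eq_bounded_closed)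
  have outside: "V z < V z1" if "z \<in> unit_disk" "z \<notin> T" for z
  proof -
    have "V z \<le> C * (1 - (cmod z)\<^sup>2) powr \<gamma>"
      using le that by blast
    also have "\<dots> < C * \<delta> powr \<gamma>"
      using that assms \<delta> by (intro mult_strict_left_mono powr_less_mono2) (auto simp: T_def abs_square_le_1)
    finally show ?thesis
      using \<delta> assms by simp
  qed
  then have "z1 \<in> T"
    using z1 by blast
  then obtain z0 where "z0 \<in> T" "\<And>z. z \<in> T \<Longrightarrow> V z \<le> V z0"
    using continuous_attains_sup[of T V] \<open>compact T\<close> continuous_on_subset[OF assms(1) T] by blast
  then show ?thesis
    using that[of z0] T outside \<open>z1 \<in> T\<close> by (meson less_le_trans less_imp_le subsetD)
qed

theorem theorem2p2:
  fixes \<alpha> \<epsilon> :: real and X :: "(complex \<times> nat) set" and K :: "complex set"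
  assumes "\<alpha> > 0" and "\<epsilon> > 0"
    and "divisor X"
    and "compact K" and "K \<subseteq> unit_disk"
    and "(\<Union>(w, m)\<in>X. pseudohyperbolic_disk w (sqrt (real m / (\<alpha> + \<epsilon> + real m)))) = unit_disk - K"
  shows "uniqueness_divisor X (growth_space \<alpha>)"
  unfolding uniqueness_divisor_def
proof (rule ballI, rule impI, rule ccontr)
  fix f assume f: "f \<in> growth_space \<alpha>"
    and zeros: "\<forall>(w, m)\<in>X. \<forall>j<m. (deriv ^^ j) f w = 0"
    and "\<not> (\<forall>z\<in>unit_disk. f z = 0)"
  then obtain z' where z': "z' \<in> unit_disk" "f z' \<noteq> 0"
    by blast
  have hol: "f holomorphic_on unit_disk"
    using f by (simp add: growth_space_def)
  obtain C where C: "0 < C"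
    "\<And>z. z \<in> unit_disk \<Longrightarrow> (1 - (cmod z)\<^sup>2) powr (\<alpha> / 2) * cmod (f z) \<le> C"
    using growth_space_bound[OF f] by blast
  obtain \<rho> where \<rho>: "0 \<le> \<rho>" "\<rho> < 1" "\<And>z. z \<in> K \<Longrightarrow> cmod z \<le> \<rho>"
  proof (cases "K = {}")
    case True
    then show ?thesis using that[of 0] by simp
  next
    case False
    then obtain k where "k \<in> K" "\<And>z. z \<in> K \<Longrightarrow> cmod z \<le> cmod k"
      using continuous_attains_sup[of K cmod] \<open>compact K\<close> by (auto intro: continuous_intros)
    then show ?thesis
      using that[of "cmod k"] \<open>K \<subseteq> unit_disk\<close> by auto
  qed
  obtain z1 where z1: "z1 \<in> unit_disk" "\<rho> < cmod z1" "f z1 \<noteq> 0"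
    using holomorphic_on_disk_nonzero_near_boundary[OF hol z' \<rho>(1,2)] .
  define \<beta> where "\<beta> = \<alpha> + \<epsilon>"
  have "0 < \<beta>"
    using assms by (simp add: \<beta>_def)
  define U where "U z = (1 - (cmod z)\<^sup>2) powr (\<beta> / 2) * cmod (f z)" for z
  have U_le: "U z \<le> C * (1 - (cmod z)\<^sup>2) powr (\<epsilon> / 2)" if "z \<in> unit_disk" for z
    using mult_right_mono[OF C(2)[OF that], of "(1 - (cmod z)\<^sup>2) powr (\<epsilon> / 2)"]
    by (simp add: U_def \<beta>_def add_divide_distrib powr_add mult_ac)
  have "0 < U z1"
    using z1 abs_square_less_1[of "cmod z1"] by (simp add: U_def)
  have "0 < cmod z1"
    using z1 \<rho> by linarith
  \<comment> \<open>Chosen so that \<open>\<rho> ^ N * C\<close>, which bounds \<open>V\<close> on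
    \<open>K\<close>, is less than \<open>V z1 = cmod z1 ^ N * U z1\<close>.\<close>
  obtain N where N: "(\<rho> / cmod z1) ^ N < U z1 / C"
    using real_arch_pow_inv[of "U z1 / C" "\<rho> / cmod z1"] \<open>0 < cmod z1\<close> \<open>0 < U z1\<close> C(1) z1 \<rho> by fastforce
  define V where "V z = (1 - (cmod z)\<^sup>2) powr (\<beta> / 2) * cmod (z ^ N * f z)" for z
  have V_eq: "V z = cmod z ^ N * U z" for z
    by (simp add: V_def U_def norm_mult norm_power)
  have "0 < V z1"
    using \<open>0 < U z1\<close> \<open>0 < cmod z1\<close> by (simp add: V_eq)
  have cont: "continuous_on unit_disk V"
    unfolding V_def using hol \<open>0 < \<beta>\<close>
    by (intro continuous_intros holomorphic_on_imp_continuous_on) (auto simp: abs_square_less_1 abs_square_eq_1)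
  have V_le: "V z \<le> C * (1 - (cmod z)\<^sup>2) powr (\<epsilon> / 2)" if "z \<in> unit_disk" for z
  proof -
    have "V z \<le> 1 * U z"
      unfolding V_eq using that by (intro mult_right_mono) (auto simp: power_le_one U_def)
    then show ?thesis
      using U_le[OF that] by simp
  qed
  obtain z0 where z0: "z0 \<in> unit_disk" "\<And>z. z \<in> unit_disk \<Longrightarrow> V z \<le> V z0"
    using continuous_decay_attains_max_on_disk[OF cont _ C(1) V_le z1(1) \<open>0 < V z1\<close>] assms(2) by auto
  have "z0 \<notin> K"
  proof
    assume "z0 \<in> K"
    have "(1 - (cmod z0)\<^sup>2) powr (\<epsilon> / 2) \<le> 1"
      using z0(1) \<open>\<epsilon> > 0\<close> by (intro powr_le1) (auto simp: abs_square_le_1)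
    then have "U z0 \<le> C"
      using U_le[OF z0(1)] C(1) by (meson mult_left_le less_imp_le order_trans)
    then have "V z0 \<le> \<rho> ^ N * C"
      unfolding V_eq using \<rho>(3)[OF \<open>z0 \<in> K\<close>] \<rho>(1)
      by (intro mult_mono power_mono) (auto simp: U_def)
    also have "\<dots> < V z1"
      using N C(1) \<open>0 < cmod z1\<close> by (simp add: V_eq power_divide field_simps)
    finally show False
      using z0(2)[OF z1(1)] by simp
  qed
  then obtain w m where wm: "(w, m) \<in> X"
    "z0 \<in> pseudohyperbolic_disk w (sqrt (real m / (\<beta> + real m)))"
    using assms(6) z0(1) unfolding \<beta>_def by blast
  have w: "w \<in> unit_disk" "1 \<le> m"
    using \<open>divisor X\<close> wm(1) by (auto simp: divisor_def)
  obtain h where h: "h holomorphic_on unit_disk" "\<And>z. z \<in> unit_disk \<Longrightarrow> f z = (z - w) ^ m * h z"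
    using holomorphic_factor_zero_of_order[OF hol open_ball w(1), of m] zeros wm(1) by blast
  have eq: "(z - w) ^ m * (z ^ N * h z) = z ^ N * f z" if "z \<in> unit_disk" for z
    using h(2)[OF that] by simp
  have "0 < V z0"
    using \<open>0 < V z1\<close> z0(2)[OF z1(1)] by linarith
  then have nz: "(z0 - w) ^ m * (z0 ^ N * h z0) \<noteq> 0"
    unfolding eq[OF z0(1)] by (auto simp: V_def)
  have "(\<lambda>z. z ^ N * h z) holomorphic_on unit_disk"
    by (intro holomorphic_intros h)
  \<comment> \<open>The holomorphic cofactor is \<open>z ^ N * h z\<close>, so the weighted modulus
    being compared is \<open>V\<close> itself.\<close>
  from exists_greater_weighted_value[OF \<open>0 < \<beta>\<close> w(2,1) this wm(2) nz]
  obtain z where "z \<in> unit_disk" "V z0 < V z"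
    by (metis V_def eq z0(1))
  then show False
    using z0(2) by force
qed

end
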